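(* $\Pi^1_1\text{-}\mathsf{LNP}\equiv_{\mathsf W}\#\Sigma^1_1$ and $\Sigma^1_1\text{-}\mathsf{LNP}\equiv_{\mathsf W}\#\Pi^1_1$.
   Context: $\boldsymbol{\Pi}^1_1(\omega)$ (all $\boldsymbol{\Pi}^1_1$ subsets of $\omega$) is represented by $\delta_{\Pi^1_1}:\omega^\omega\to\boldsymbol{\Pi}^1_1(\omega)$, where $\delta_{\Pi^1_1}(e^\frown p)$ is the $e$-th $\Pi^1_1(p)$ subset of $\omega$ (standard effective enumeration); $\boldsymbol{\Sigma}^1_1(\omega)$ is represented by $\delta_{\Sigma^1_1}(x)=\omega\setminus\delta_{\Pi^1_1}(x)$. For $\Gamma\in\{\Pi^1_1,\Sigma^1_1\}$: $\Gamma\text{-}\mathsf{LNP}:\subseteq\boldsymbol{\Gamma}(\omega)\to\omega$ maps $A$ to $\min A$ if $A\neq\emptyset$ and is undefined at $\emptyset$; $\#\Gamma:\subseteq\boldsymbol{\Gamma}(\omega)\to\omega$ maps $A$ to its cardinality $\#A$ if $A$ is finite and is undefined otherwise. Weihrauch reducibility: $f\le_{\mathsf W}g$ if there are partial computable $h,k$ on $\omega^\omega$ such that for every name $\mathtt{x}$ of some $x\in{\rm dom}(f)$, $h(\mathtt{x})$ is a name of some $x^\ast\in{\rm dom}(g)$, and whenever $\mathtt{y}$ is a name of $g(x^\ast)$, $k(\mathtt{x},\mathtt{y})$ is a name of $f(x)$ ($\omega$ carries its standard representation). $f\equiv_{\mathsf W}g$ means $f\le_{\mathsf W}g$ and $g\le_{\mathsf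 W}f$. *)

theory Defs
  imports Main "HOL-Library.Nat_Bijection"
begin

section \<open>Partial recursive functions with an oracle\<close>

type_synonym baire = "nat \<Rightarrow> nat"

text \<open>
  Unary presentation of Kleene's partial recursive functions relative to an oracle in Baire space.
  Several arguments are passed as one number by the Cantor pairing \<^const>\<open>prod_encode\<close>; the
  identity is \<open>Tuple Fst Snd\<close>, since that pairing is onto.
\<close>

datatype prog =
    Zero
  | Succ
  | Fst
  | Snd
  | Query
  | Tuple prog prog
  | Comp prog prog
  | Rec prog prog
  | Mu prog

primrec eval :: "baire \<Rightarrow> prog \<Rightarrow> nat \<rightharpoonup> nat" where
  "eval p Zero = (\<lambda>x. Some 0)"
| "eval p Succ = (\<lambda>x. Some (Suc x))"
| "eval p Fst = (\<lambda>x. Some (fst (prod_decode x)))"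
| "eval p Snd = (\<lambda>x. Some (snd (prod_decode x)))"
| "eval p Query = (\<lambda>x. Some (p x))"
| "eval p (Tuple c d) = (\<lambda>x. Option.bind (eval p c x) (\<lambda>a.
     Option.bind (eval p d x) (\<lambda>b. Some (prod_encode (a, b)))))"
| "eval p (Comp c d) = (\<lambda>x. Option.bind (eval p d x) (eval p c))"
| "eval p (Rec c d) = (\<lambda>z. case prod_decode z of (x, n) \<Rightarrow>
     rec_nat (eval p c x)
       (\<lambda>m r. Option.bind r (\<lambda>v. eval p d (prod_encode (x, prod_encode (m, v))))) n)"
| "eval p (Mu c) = (\<lambda>x. let n = (LEAST n. eval p c (prod_encode (x, n)) = Some 0) in
     if eval p c (prod_encode (x, n)) = Some 0 \<and> (\<forall>m<n. eval p c (prod_encode (x, m)) \<noteq> None)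
     then Some n else None)"

text \<open>An effective Goedel numbering, bijective between programs and natural numbers.\<close>

primrec code :: "prog \<Rightarrow> nat" where
  "code Zero = 0"
| "code Succ = 1"
| "code Fst = 2"
| "code Snd = 3"
| "code Query = 4"
| "code (Tuple c d) = 5 + 4 * prod_encode (code c, code d)"
| "code (Comp c d) = 6 + 4 * prod_encode (code c, code d)"
| "code (Rec c d) = 7 + 4 * prod_encode (code c, code d)"
| "code (Mu c) = 8 + 4 * code c"

lemma inj_code: "code c = code d \<Longrightarrow> c = d"
proof (induction c arbitrary: d)
  case Zero then show ?case by (cases d) auto
next
  case Succ then show ?case by (cases d) auto
next
  case Fst then show ?case by (cases d) auto
next
  case Snd then show ?case by (cases d) auto
next
  case Query then show ?case by (cases d) auto
next
  case (Tuple c1 c2) then show ?case by (cases d) (auto, presburger+)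
next
  case (Comp c1 c2) then show ?case by (cases d) (auto, presburger+)
next
  case (Rec c1 c2) then show ?case by (cases d) (auto, presburger+)
next
  case (Mu c) then show ?case by (cases d) (auto, presburger+)
qed

lemma surj_code: "\<exists>c. code c = n"
proof (induction n rule: less_induct)
  case (less n)
  show ?case
  proof (cases "n < 5")
    case True
    then have "n = 0 \<or> n = 1 \<or> n = 2 \<or> n = 3 \<or> n = 4" by auto
    then show ?thesis
      by (metis code.simps(1) code.simps(2) code.simps(3) code.simps(4) code.simps(5))
  next
    case False
    define m where "m = (n - 5) div 4"
    obtain a b where ab: "m = prod_encode (a, b)" by (metis prod_decode_inverse surj_pair)
    have "m < n" using False by (simp add: m_def)
    moreover have "a \<le> m" "b \<le> m" using ab le_prod_encode_1 le_prod_encode_2 by auto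
    ultimately obtain c d e where c: "code c = a" "code d = b" "code e = m"
      using less by (meson le_less_trans)
    have "n = 5 + 4*m \<or> n = 6 + 4*m \<or> n = 7 + 4*m \<or> n = 8 + 4*m"
      using False unfolding m_def by presburger
    then show ?thesis
      using c ab by (metis code.simps(6) code.simps(7) code.simps(8) code.simps(9))
  qed
qed

lemma bij_code: "bij code"
  by (metis bijI injI inj_code surjI surj_code)

text \<open>The \<open>e\<close>-th partial recursive function with oracle \<open>p\<close>.\<close>

definition phi :: "baire \<Rightarrow> nat \<Rightarrow> nat \<rightharpoonup> nat" where
  "phi p e = eval p (inv code e)"

section \<open>Partial computable functions on Baire space\<close>

definition functional :: "prog \<Rightarrow> baire \<rightharpoonup> baire" where
  "functional c x =
     (if \<forall>n. eval x c n \<noteq> None then Some (\<lambda>n. the (eval x c n)) else None)"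

text \<open>As usual in computable analysis, the domain of a computable partial function may be any
  subset of the set on which the underlying program succeeds.\<close>

definition partial_computable :: "(baire \<rightharpoonup> baire) \<Rightarrow> bool" where
  "partial_computable h \<longleftrightarrow> (\<exists>c. h \<subseteq>\<^sub>m functional c)"

definition join :: "baire \<Rightarrow> baire \<Rightarrow> baire" where
  "join x y n = (if even n then x (n div 2) else y (n div 2))"

section \<open>Weihrauch reducibility\<close>

text \<open>A representation is a partial surjection from Baire space; the represented set is its range
  \<^const>\<open>ran\<close>.\<close>

type_synonym 'a representation = "baire \<rightharpoonup> 'a"

record ('a, 'b) problem =
  in_rep :: "'a representation"
  out_rep :: "'b representation"
  solution :: "'a \<rightharpoonup> 'b"

definition weihrauch_le :: "('a, 'b) problem \<Rightarrow> ('c, 'd) problem \<Rightarrow> bool"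
    (infix "\<le>\<^sub>W" 50) where
  "f \<le>\<^sub>W g \<longleftrightarrow> (\<exists>h k. partial_computable h \<and> partial_computable k \<and>
     (\<forall>x a b. in_rep f x = Some a \<and> solution f a = Some b \<longrightarrow>
       (\<exists>x' a' b'. h x = Some x' \<and> in_rep g x' = Some a' \<and> solution g a' = Some b' \<and>
         (\<forall>y. out_rep g y = Some b' \<longrightarrow>
           (\<exists>z. k (join x y) = Some z \<and> out_rep f z = Some b)))))"

definition weihrauch_equiv :: "('a, 'b) problem \<Rightarrow> ('c, 'd) problem \<Rightarrow> bool"
    (infix "\<equiv>\<^sub>W" 50) where
  "f \<equiv>\<^sub>W g \<longleftrightarrow> f \<le>\<^sub>W g \<and> g \<le>\<^sub>W f"

definition delta_omega :: "nat representation" where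
  "delta_omega x = Some (x 0)"

section \<open>The represented pointclasses\<close>

text \<open>
  By the normal form theorem the \<open>\<Pi>\<^sup>1\<^sub>1(p)\<close> subsets of \<open>\<omega>\<close> are those of the form
  \<open>{n. \<forall>f. R p f n}\<close> with \<open>R\<close> a \<open>\<Sigma>\<^sup>0\<^sub>1\<close> relation, i.e. the domain of a partial recursive function
  with oracle \<open>p \<oplus> f\<close>; the \<open>e\<close>-th one uses the \<open>e\<close>-th partial recursive function.
\<close>

definition Pi11_enum :: "nat \<Rightarrow> baire \<Rightarrow> nat set" where
  "Pi11_enum e p = {n. \<forall>f. n \<in> dom (phi (join p f) e)}"

definition Pi11_omega :: "nat set set" where
  "Pi11_omega = (\<Union>p. range (\<lambda>e. Pi11_enum e p))"

definition Sigma11_omega :: "nat set set" where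
  "Sigma11_omega = {- A | A. A \<in> Pi11_omega}"

definition delta_Pi11 :: "nat set representation" where
  "delta_Pi11 x = Some (Pi11_enum (x 0) (\<lambda>n. x (Suc n)))"

definition delta_Sigma11 :: "nat set representation" where
  "delta_Sigma11 x = map_option uminus (delta_Pi11 x)"

lemma delta_Pi11_concat: "delta_Pi11 (case_nat e p) = Some (Pi11_enum e p)"
  by (simp add: delta_Pi11_def)

lemma ran_delta_Pi11: "ran delta_Pi11 = Pi11_omega"
proof
  show "ran delta_Pi11 \<subseteq> Pi11_omega"
    by (auto simp: ran_def delta_Pi11_def Pi11_omega_def)
  show "Pi11_omega \<subseteq> ran delta_Pi11"
    using delta_Pi11_concat by (fastforce simp: ran_def Pi11_omega_def)
qed

lemma ran_delta_Sigma11: "ran delta_Sigma11 = Sigma11_omega"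
  unfolding Sigma11_omega_def ran_delta_Pi11[symmetric]
  by (auto simp: ran_def delta_Sigma11_def)

section \<open>Least number and cardinality problems\<close>

definition least_number :: "nat set set \<Rightarrow> nat set \<rightharpoonup> nat" where
  "least_number \<Gamma> A = (if A \<in> \<Gamma> \<and> A \<noteq> {} then Some (LEAST n. n \<in> A) else None)"

definition cardinality :: "nat set set \<Rightarrow> nat set \<rightharpoonup> nat" where
  "cardinality \<Gamma> A = (if A \<in> \<Gamma> \<and> finite A then Some (card A) else None)"

definition Pi11_LNP :: "(nat set, nat) problem" where
  "Pi11_LNP = \<lparr>in_rep = delta_Pi11, out_rep = delta_omega, solution = least_number Pi11_omega\<rparr>"

definition Sigma11_LNP :: "(nat set, nat) problem" where
  "Sigma11_LNP =
     \<lparr>in_rep = delta_Sigma11, out_rep = delta_omega, solution = least_number Sigma11_omega\<rparr>"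

definition card_Pi11 :: "(nat set, nat) problem" where
  "card_Pi11 = \<lparr>in_rep = delta_Pi11, out_rep = delta_omega, solution = cardinality Pi11_omega\<rparr>"

definition card_Sigma11 :: "(nat set, nat) problem" where
  "card_Sigma11 =
     \<lparr>in_rep = delta_Sigma11, out_rep = delta_omega, solution = cardinality Sigma11_omega\<rparr>"

end

theory Submission imports Defs
begin

text \<open>
  For a name \<open>x\<close> of a \<open>\<Pi>\<^sup>1\<^sub>1\<close> set \<open>P\<close>, the least element of \<open>P\<close> is the number of \<open>n\<close> such that no
  \<open>m \<le> n\<close> is in \<open>P\<close>, and the cardinality of a finite \<open>P\<close> is the least \<open>n\<close> such that every finite
  subset of \<open>P\<close> has at most \<open>n\<close> elements; likewise for \<open>- P\<close>. Each of the four sets of numbers \<open>n\<close>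
  arises from \<open>P\<close> by number quantifiers, under which \<open>\<Pi>\<^sup>1\<^sub>1\<close> is closed uniformly in \<open>x\<close>. Hence it,
  or its complement, has an index \<open>e\<close> that does not depend on \<open>x\<close>, and prefixing \<open>e\<close> to \<open>x\<close>
  reduces one problem to the other without changing the answer.
\<close>

section \<open>Total computable functionals\<close>

abbreviation pfst :: "nat \<Rightarrow> nat" where "pfst z \<equiv> fst (prod_decode z)"
abbreviation psnd :: "nat \<Rightarrow> nat" where "psnd z \<equiv> snd (prod_decode z)"

text \<open>One program works for all oracles; this uniformity later yields an index independent of
  the name.\<close>

definition computable :: "(baire \<Rightarrow> nat \<Rightarrow> nat) \<Rightarrow> bool" where
  "computable F \<longleftrightarrow> (\<exists>c. \<forall>p z. eval p c z = Some (F p z))"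

definition decidable :: "(baire \<Rightarrow> nat \<Rightarrow> bool) \<Rightarrow> bool" where
  "decidable P \<longleftrightarrow> computable (\<lambda>p z. of_bool (P p z))"

named_theorems computable_intros

lemma computable_compose:
  assumes "computable F" "computable t"
  shows "computable (\<lambda>p z. F p (t p z))"
proof -
  obtain c d where "\<forall>p z. eval p c z = Some (F p z)" "\<forall>p z. eval p d z = Some (t p z)"
    using assms by (auto simp: computable_def)
  then have "\<forall>p z. eval p (Comp c d) z = Some (F p (t p z))" by simp
  then show ?thesis unfolding computable_def by blast
qed

lemma computable_Suc [computable_intros]:
  "computable t \<Longrightarrow> computable (\<lambda>p z. Suc (t p z))"
  by (rule computable_compose[of "\<lambda>p. Suc"]) (auto simp: computable_def intro!: exI[of _ Succ])

lemma computable_pfst [computable_intros]: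
  "computable t \<Longrightarrow> computable (\<lambda>p z. pfst (t p z))"
  by (rule computable_compose[of "\<lambda>p. pfst"]) (auto simp: computable_def intro!: exI[of _ Fst])

lemma computable_psnd [computable_intros]:
  "computable t \<Longrightarrow> computable (\<lambda>p z. psnd (t p z))"
  by (rule computable_compose[of "\<lambda>p. psnd"]) (auto simp: computable_def intro!: exI[of _ Snd])

lemma computable_query [computable_intros]:
  "computable t \<Longrightarrow> computable (\<lambda>p z. p (t p z))"
  by (rule computable_compose[of "\<lambda>p. p"]) (auto simp: computable_def intro!: exI[of _ Query])

lemma computable_pair [computable_intros]:
  assumes "computable s" "computable t"
  shows "computable (\<lambda>p z. prod_encode (s p z, t p z))"
proof -
  obtain c d where "\<forall>p z. eval p c z = Some (s p z)" "\<forall>p z. eval p d z = Some (t p z)"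
    using assms by (auto simp: computable_def)
  then have "\<forall>p z. eval p (Tuple c d) z = Some (prod_encode (s p z, t p z))" by simp
  then show ?thesis unfolding computable_def by blast
qed

lemma computable_id [computable_intros]: "computable (\<lambda>p z. z)"
  unfolding computable_def by (rule exI[of _ "Tuple Fst Snd"]) simp

lemma computable_const [computable_intros]: "computable (\<lambda>p z. n)"
proof (induction n)
  case 0
  show ?case unfolding computable_def by (rule exI[of _ Zero]) simp
qed (rule computable_Suc)

lemma computable_rec:
  assumes "computable f" "computable t"
    and "computable (\<lambda>p w. g p (pfst w) (pfst (psnd w)) (psnd (psnd w)))"
  shows "computable (\<lambda>p z. rec_nat (f p z) (\<lambda>m v. g p z m v) (t p z))"
proof -
  obtain c d where c: "\<forall>p z. eval p c z = Some (f p z)"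
    and d: "\<forall>p w. eval p d w = Some (g p (pfst w) (pfst (psnd w)) (psnd (psnd w)))"
    using assms by (auto simp: computable_def)
  have "rec_nat (Some (f p z)) (\<lambda>m r. Option.bind r (\<lambda>v. Some (g p z m v))) n
      = Some (rec_nat (f p z) (g p z) n)" for p z n
    by (induction n) auto
  then have "eval p (Rec c d) z = Some (rec_nat (f p (pfst z)) (g p (pfst z)) (psnd z))" for p z
    using c d by (simp add: case_prod_beta)
  then have "computable (\<lambda>p z. rec_nat (f p (pfst z)) (g p (pfst z)) (psnd z))"
    unfolding computable_def by blast
  from computable_compose[OF this computable_pair[OF computable_id assms(2)]]
  show ?thesis by simp
qed

section \<open>Arithmetic, bounded quantifiers and codes of finite sets\<close>

lemma computable_add [computable_intros]:
  assumes "computable s" "computable t" shows "computable (\<lambda>p z. s p z + t p z)"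
proof -
  have "a + b = rec_nat a (\<lambda>m v. Suc v) b" for a b :: nat by (induction b) auto
  then show ?thesis using assms by (auto intro!: computable_rec computable_intros)
qed

lemma computable_diff [computable_intros]:
  assumes "computable s" "computable t" shows "computable (\<lambda>p z. s p z - t p z)"
proof -
  have *: "a - Suc 0 = rec_nat 0 (\<lambda>m v. m) a" for a :: nat by (cases a) auto
  have "a - b = rec_nat a (\<lambda>m v. v - Suc 0) b" for a b :: nat by (induction b) auto
  then show ?thesis using assms unfolding * by (auto intro!: computable_rec computable_intros)
qed

lemma computable_sum [computable_intros]:
  assumes "computable t" "computable (\<lambda>p w. f p (pfst w) (psnd w))"
  shows "computable (\<lambda>p z. \<Sum>i<t p z. f p z i)"
proof -
  have "sum h {..<b} = rec_nat 0 (\<lambda>m v. v + h m) b" for h :: "nat \<Rightarrow> nat" and b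
    by (induction b) auto
  moreover have "computable (\<lambda>p w. f p (pfst w) (pfst (psnd w)))"
    using computable_compose[OF assms(2), of "\<lambda>p w. prod_encode (pfst w, pfst (psnd w))"]
    by (simp add: computable_intros)
  ultimately show ?thesis using assms(1) by (auto intro!: computable_rec computable_intros)
qed

lemma computable_mult [computable_intros]:
  assumes "computable s" "computable t" shows "computable (\<lambda>p z. s p z * t p z)"
proof -
  have "computable (\<lambda>p w. t p (pfst w))"
    by (intro computable_compose[OF assms(2)] computable_intros)
  from computable_sum[OF assms(1) this] show ?thesis by simp
qed

lemma computable_power [computable_intros]:
  assumes "computable s" "computable t" shows "computable (\<lambda>p z. s p z ^ t p z)"
proof -
  have "a ^ b = rec_nat 1 (\<lambda>m v. a * v) b" for a b :: nat by (induction b) auto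
  moreover have "computable (\<lambda>p w. s p (pfst w))"
    by (intro computable_compose[OF assms(1)] computable_intros)
  ultimately show ?thesis using assms by (auto intro!: computable_rec computable_intros)
qed

lemma computable_of_bool [computable_intros]:
  "decidable P \<Longrightarrow> computable (\<lambda>p z. of_bool (P p z))"
  by (simp add: decidable_def)

lemma decidable_compose:
  "decidable P \<Longrightarrow> computable t \<Longrightarrow> decidable (\<lambda>p z. P p (t p z))"
  unfolding decidable_def by (rule computable_compose)

lemma computable_if [computable_intros]:
  assumes "decidable P" "computable s" "computable t"
  shows "computable (\<lambda>p z. if P p z then s p z else t p z)"
proof -
  have *: "(\<lambda>p z. if P p z then s p z else t p z) =
      (\<lambda>p z. of_bool (P p z) * s p z + (1 - of_bool (P p z)) * t p z)"
    by (auto simp: fun_eq_iff)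
  show ?thesis unfolding * by (intro computable_intros assms)
qed

lemma decidable_le [computable_intros]:
  assumes "computable s" "computable t" shows "decidable (\<lambda>p z. s p z \<le> t p z)"
proof -
  have *: "of_bool (a \<le> b) = (1::nat) - (a - b)" for a b :: nat by auto
  show ?thesis unfolding decidable_def * by (intro computable_intros assms)
qed

lemma decidable_less [computable_intros]:
  "computable s \<Longrightarrow> computable t \<Longrightarrow> decidable (\<lambda>p z. s p z < t p z)"
  unfolding less_eq_Suc_le by (intro computable_intros)

lemma decidable_not [computable_intros]:
  assumes "decidable P" shows "decidable (\<lambda>p z. \<not> P p z)"
proof -
  have *: "of_bool (\<not> a) = (1::nat) - of_bool a" for a by simp
  show ?thesis unfolding decidable_def * by (intro computable_intros assms)
qed

lemma decidable_conj [computable_intros]: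
  "decidable P \<Longrightarrow> decidable Q \<Longrightarrow> decidable (\<lambda>p z. P p z \<and> Q p z)"
  unfolding decidable_def of_bool_conj by (rule computable_mult)

lemma decidable_disj [computable_intros]:
  assumes "decidable P" "decidable Q" shows "decidable (\<lambda>p z. P p z \<or> Q p z)"
proof -
  have "decidable (\<lambda>p z. \<not> (\<not> P p z \<and> \<not> Q p z))" by (intro computable_intros assms)
  then show ?thesis by simp
qed

lemma decidable_imp [computable_intros]:
  "decidable P \<Longrightarrow> decidable Q \<Longrightarrow> decidable (\<lambda>p z. P p z \<longrightarrow> Q p z)"
  unfolding imp_conv_disj by (intro computable_intros)

lemma decidable_eq [computable_intros]:
  "computable s \<Longrightarrow> computable t \<Longrightarrow> decidable (\<lambda>p z. s p z = t p z)"
  unfolding eq_iff by (intro computable_intros)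

lemma decidable_ex_less [computable_intros]:
  assumes "computable t" "decidable (\<lambda>p w. P p (pfst w) (psnd w))"
  shows "decidable (\<lambda>p z. \<exists>i<t p z. P p z i)"
proof -
  have *: "(\<exists>i<b. R i) \<longleftrightarrow> 0 < (\<Sum>i<b. of_bool (R i) :: nat)" for b :: nat and R
    by (auto simp: sum_pos2 simp flip: neq0_conv)
  show ?thesis unfolding * by (intro computable_intros assms)
qed

lemma decidable_all_less [computable_intros]:
  assumes "computable t" "decidable (\<lambda>p w. P p (pfst w) (psnd w))"
  shows "decidable (\<lambda>p z. \<forall>i<t p z. P p z i)"
proof -
  have "decidable (\<lambda>p z. \<not> (\<exists>i<t p z. \<not> P p z i))" by (intro computable_intros assms)
  then show ?thesis by simp
qed

lemma computable_div [computable_intros]: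
  assumes "computable s" "computable t" shows "computable (\<lambda>p z. s p z div t p z)"
proof -
  \<comment> \<open>The quotient counts the positive multiples of \<open>b\<close> up to
    \<open>a\<close>; for \<open>b = 0\<close>, division returns 0 by convention.\<close>
  have div_eq: "a div b = (if b = 0 then 0 else \<Sum>i<a. of_bool (Suc i * b \<le> a))" for a b :: nat
  proof (cases "b = 0")
    case False
    have "{i. i < a \<and> Suc i * b \<le> a} = {..<a div b}"
    proof (rule set_eqI)
      fix i
      have "Suc i * b \<le> a \<longleftrightarrow> i < a div b"
        using False by (metis Suc_le_eq less_eq_div_iff_mult_less_eq neq0_conv)
      moreover have "a div b \<le> a" by simp
      ultimately show "i \<in> {i. i < a \<and> Suc i * b \<le> a} \<longleftrightarrow> i \<in> {..<a div b}"
        by (metis (mono_tags, lifting) lessThan_iff mem_Collect_eq order_less_le_trans)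
    qed
    moreover have "(\<Sum>i<a. of_bool (Suc i * b \<le> a)) = card {i. i < a \<and> Suc i * b \<le> a}"
      by (subst sum_of_bool_eq) (auto intro: arg_cong[of _ _ card])
    ultimately show ?thesis using False by simp
  qed simp
  have "computable (\<lambda>p w. s p (pfst w))" "computable (\<lambda>p w. t p (pfst w))"
    by (intro computable_compose[OF assms(1)] computable_compose[OF assms(2)] computable_intros)+
  then show ?thesis unfolding div_eq by (intro computable_intros assms)
qed

lemma decidable_even [computable_intros]:
  assumes "computable t" shows "decidable (\<lambda>p z. even (t p z))"
proof -
  have *: "even a \<longleftrightarrow> 2 * (a div 2) = a" for a :: nat by presburger
  show ?thesis unfolding * by (intro computable_intros assms)
qed

lemma decidable_set_decode [computable_intros]:
  "computable s \<Longrightarrow> computable t \<Longrightarrow> decidable (\<lambda>p z. s p z \<in> set_decode (t p z))"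
  by (simp add: set_decode_def computable_intros)

lemma computable_card_set_decode [computable_intros]:
  assumes "computable t" shows "computable (\<lambda>p z. card (set_decode (t p z)))"
proof -
  have card_eq: "card (set_decode w) = (\<Sum>i<w. of_bool (i \<in> set_decode w))" for w
  proof -
    \<comment> \<open>A digit 1 at position \<open>i\<close> forces \<open>2 ^ i <= w\<close>, so a
      sum over the numbers below \<open>w\<close> counts every element.\<close>
    have "i < w" if "i \<in> set_decode w" for i
    proof -
      have "\<not> w < 2 ^ i" using that by (auto simp: set_decode_def)
      then show ?thesis using less_exp[of i] by linarith
    qed
    then have "set_decode w = {..<w} \<inter> {i. i \<in> set_decode w}" by auto
    then show ?thesis by (simp add: sum_of_bool_eq)
  qed
  have "computable (\<lambda>p w. t p (pfst w))"
    by (intro computable_compose[OF assms] computable_intros)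
  then show ?thesis unfolding card_eq by (intro computable_intros assms)
qed

section \<open>Substitution of a computable oracle\<close>

text \<open>The parameter \<open>m\<close> is threaded through every subprogram, and queries are
  answered by \<open>q\<close>. Neither \<open>p\<close> nor \<open>m\<close> enters the
  construction of \<open>c'\<close>.\<close>

lemma eval_oracle_subst:
  assumes q: "\<forall>p w. eval p q w = Some (G p (pfst w) (psnd w))"
  shows "\<exists>c'. \<forall>p m z. eval p c' (prod_encode (m, z)) = eval (G p m) c z"
proof (induction c)
  case Zero
  show ?case by (rule exI[of _ Zero]) simp
next
  case Succ
  show ?case by (rule exI[of _ "Comp Succ Snd"]) simp
next
  case Fst
  show ?case by (rule exI[of _ "Comp Fst Snd"]) simp
next
  case Snd
  show ?case by (rule exI[of _ "Comp Snd Snd"]) simp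
next
  case Query
  show ?case by (rule exI[of _ q]) (simp add: q)
next
  case (Tuple c d)
  then obtain c' d' where "\<forall>p m z. eval p c' (prod_encode (m, z)) = eval (G p m) c z"
    "\<forall>p m z. eval p d' (prod_encode (m, z)) = eval (G p m) d z" by blast
  then show ?case by (intro exI[of _ "Tuple c' d'"]) simp
next
  case (Comp c d)
  then obtain c' d' where "\<forall>p m z. eval p c' (prod_encode (m, z)) = eval (G p m) c z"
    "\<forall>p m z. eval p d' (prod_encode (m, z)) = eval (G p m) d z" by blast
  then show ?case by (intro exI[of _ "Comp c' (Tuple Fst d')"]) (simp add: bind_assoc)
next
  case (Rec c d)
  then obtain c' d' where "\<forall>p m z. eval p c' (prod_encode (m, z)) = eval (G p m) c z"
    "\<forall>p m z. eval p d' (prod_encode (m, z)) = eval (G p m) d z" by blast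
  \<comment> \<open>The argument \<open>(m, (x, n))\<close> is regrouped as
    \<open>((m, x), n)\<close>, so that \<open>Rec\<close> keeps both \<open>m\<close> and
    \<open>x\<close> as its parameter. The step program receives \<open>((m, x), (i, v))\<close> and
    restores the grouping that \<open>d'\<close> expects.\<close>
  then show ?case
    by (intro exI[of _ "Comp (Rec c' (Comp d' (Tuple (Comp Fst Fst) (Tuple (Comp Snd Fst) Snd))))
          (Tuple (Tuple Fst (Comp Fst Snd)) (Comp Snd Snd))"])
      (simp add: case_prod_beta)
next
  case (Mu c)
  then obtain c' where "\<forall>p m z. eval p c' (prod_encode (m, z)) = eval (G p m) c z" by blast
  then show ?case
    by (intro exI[of _ "Mu (Comp c' (Tuple (Comp Fst Fst) (Tuple (Comp Snd Fst) Snd)))"]) simp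
qed

lemma computable_oracle_subst:
  assumes "computable F" "computable t" "computable (\<lambda>p w. G p (pfst w) (psnd w))"
  shows "computable (\<lambda>p z. F (\<lambda>j. G p z j) (t p z))"
proof -
  obtain c q where c: "\<forall>p z. eval p c z = Some (F p z)"
    and q: "\<forall>p w. eval p q w = Some (G p (pfst w) (psnd w))"
    using assms by (auto simp: computable_def)
  obtain c' where "\<forall>p m z. eval p c' (prod_encode (m, z)) = eval (G p m) c z"
    using eval_oracle_subst[OF q] by blast
  with c have "\<forall>p w. eval p c' w = Some (F (G p (pfst w)) (psnd w))"
    by (metis prod.collapse prod_decode_inverse)
  then have "computable (\<lambda>p w. F (G p (pfst w)) (psnd w))" unfolding computable_def by blast
  from computable_compose[OF this computable_pair[OF computable_id assms(2)]]
  show ?thesis by simp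
qed

lemma decidable_oracle_subst:
  assumes "decidable P" "computable t" "computable (\<lambda>p w. G p (pfst w) (psnd w))"
  shows "decidable (\<lambda>p z. P (\<lambda>j. G p z j) (t p z))"
  using assms unfolding decidable_def by (rule computable_oracle_subst)

lemma join_double [simp]: "join x y (2 * j) = x j" "join x y (Suc (2 * j)) = y j"
  by (simp_all add: join_def)

section \<open>Uniformly \<open>\<Pi>\<^sup>1\<^sub>1\<close> relations\<close>

definition pi11 :: "(baire \<Rightarrow> nat \<Rightarrow> bool) \<Rightarrow> bool" where
  "pi11 R \<longleftrightarrow> (\<exists>Q. decidable Q \<and> (\<forall>x n. R x n \<longleftrightarrow> (\<forall>g. \<exists>k. Q (join x g) (prod_encode (n, k)))))"

lemma pi11I:
  assumes "decidable Q" "\<And>x n. R x n \<longleftrightarrow> (\<forall>g. \<exists>k. Q (join x g) (prod_encode (n, k)))"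
  shows "pi11 R"
  using assms unfolding pi11_def by blast

text \<open>The index is that of the unbounded search for \<open>k\<close>. The searched function is
  total, so the search halts exactly when a witness exists.\<close>

lemma pi11_enum:
  assumes "pi11 R"
  obtains e where "\<And>x. Pi11_enum e x = {n. R x n}"
proof -
  obtain Q where Q: "decidable Q"
    and R: "\<And>x n. R x n \<longleftrightarrow> (\<forall>g. \<exists>k. Q (join x g) (prod_encode (n, k)))"
    using assms unfolding pi11_def by blast
  have "computable (\<lambda>p z. of_bool (\<not> Q p z))" by (intro computable_intros Q)
  then obtain c where c: "\<And>p z. eval p c z = Some (of_bool (\<not> Q p z))"
    unfolding computable_def by blast
  have dom_Mu: "n \<in> dom (eval p (Mu c)) \<longleftrightarrow> (\<exists>k. Q p (prod_encode (n, k)))" for p n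
    by (auto simp: c Let_def dom_def intro: LeastI)
  have "Pi11_enum (code (Mu c)) x = {n. R x n}" for x
    unfolding Pi11_enum_def phi_def inv_f_f[OF bij_is_inj[OF bij_code]] dom_Mu R ..
  then show thesis by (rule that)
qed

text \<open>The matrix in \<open>pi11\<close> sees \<open>join x g\<close>; a condition on
  \<open>x\<close> alone must read the even positions.\<close>

lemma decidable_join_left:
  assumes "decidable D"
  shows "decidable (\<lambda>p z. D (\<lambda>j. p (2 * j)) z)"
  by (rule decidable_oracle_subst[OF assms]) (intro computable_intros)+

lemma computable_join_left:
  assumes "computable t"
  shows "computable (\<lambda>p z. t (\<lambda>j. p (2 * j)) z)"
  by (rule computable_oracle_subst[OF assms]) (intro computable_intros)+

section \<open>Closure under substitution, decidable side conditions and number quantifiers\<close>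

lemma pi11_compose:
  assumes "pi11 R" "computable t"
  shows "pi11 (\<lambda>x n. R x (t x n))"
proof -
  obtain Q where Q: "decidable Q"
    and R: "\<And>x n. R x n \<longleftrightarrow> (\<forall>g. \<exists>k. Q (join x g) (prod_encode (n, k)))"
    using assms unfolding pi11_def by blast
  show ?thesis
  proof (rule pi11I)
    show "decidable (\<lambda>p w. Q p (prod_encode (t (\<lambda>j. p (2 * j)) (pfst w), psnd w)))"
      by (intro decidable_compose[OF Q] computable_intros
          computable_compose[OF computable_join_left[OF assms(2)]])
  qed (simp add: R)
qed

lemma pi11_conj:
  assumes "decidable D" "pi11 R"
  shows "pi11 (\<lambda>x n. D x n \<and> R x n)"
proof -
  obtain Q where Q: "decidable Q"
    and R: "\<And>x n. R x n \<longleftrightarrow> (\<forall>g. \<exists>k. Q (join x g) (prod_encode (n, k)))"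
    using assms unfolding pi11_def by blast
  show ?thesis
  proof (rule pi11I)
    show "decidable (\<lambda>p w. D (\<lambda>j. p (2 * j)) (pfst w) \<and> Q p w)"
      by (intro Q computable_intros decidable_compose[OF decidable_join_left[OF assms(1)]])
  qed (simp add: R)
qed

lemma pi11_disj:
  assumes "decidable D" "pi11 R"
  shows "pi11 (\<lambda>x n. D x n \<or> R x n)"
proof -
  obtain Q where Q: "decidable Q"
    and R: "\<And>x n. R x n \<longleftrightarrow> (\<forall>g. \<exists>k. Q (join x g) (prod_encode (n, k)))"
    using assms unfolding pi11_def by blast
  show ?thesis
  proof (rule pi11I)
    show "decidable (\<lambda>p w. D (\<lambda>j. p (2 * j)) (pfst w) \<or> Q p w)"
      by (intro Q computable_intros decidable_compose[OF decidable_join_left[OF assms(1)]])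
  qed (simp add: R)
qed

text \<open>The value \<open>g 0\<close> of the universally quantified function serves as the number \<open>m\<close>.\<close>

lemma pi11_all:
  assumes "pi11 (\<lambda>x w. R x (pfst w) (psnd w))"
  shows "pi11 (\<lambda>x n. \<forall>m. R x n m)"
proof -
  obtain Q where Q: "decidable Q"
    and R: "\<And>x w. R x (pfst w) (psnd w) \<longleftrightarrow> (\<forall>g. \<exists>k. Q (join x g) (prod_encode (w, k)))"
    using assms unfolding pi11_def by blast
  \<comment> \<open>Position 1 of \<open>join x g\<close> holds \<open>g 0\<close>; reading odd
    positions two places further drops it.\<close>
  let ?G = "\<lambda>p j. if even j then p j else p (j + 2)"
  have G: "?G (join x g) = join x (\<lambda>i. g (Suc i))" for x g
    by (auto simp: join_def fun_eq_iff)
  have R': "(\<forall>m. R x n m) \<longleftrightarrow>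
      (\<forall>g. \<exists>k. Q (join x (\<lambda>i. g (Suc i))) (prod_encode (prod_encode (n, g 0), k)))"
    (is "?l \<longleftrightarrow> ?r") for x n
  proof
    assume ?l
    show ?r
    proof
      fix g :: baire
      from \<open>?l\<close> have "R x n (g 0)" by blast
      then show "\<exists>k. Q (join x (\<lambda>i. g (Suc i))) (prod_encode (prod_encode (n, g 0), k))"
        using R[of x "prod_encode (n, g 0)"] by auto
    qed
  next
    assume r: ?r
    show ?l
    proof
      fix m
      have "\<exists>k. Q (join x g) (prod_encode (prod_encode (n, m), k))" for g
        using spec[OF r, of "case_nat m g"] by simp
      then show "R x n m" using R[of x "prod_encode (n, m)"] by simp
    qed
  qed
  show ?thesis
  proof (rule pi11I)
    show "decidable (\<lambda>p w. Q (?G p) (prod_encode (prod_encode (pfst w, p 1), psnd w)))"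
      by (rule decidable_oracle_subst[OF Q]) (intro computable_intros)+
  next
    have "join x g (Suc 0) = g 0" for x g by (simp add: join_def)
    then show "(\<forall>m. R x n m) \<longleftrightarrow> (\<forall>g. \<exists>k. Q (?G (join x g)) (prod_encode (prod_encode
        (pfst (prod_encode (n, k)), join x g 1), psnd (prod_encode (n, k)))))" for x n
      unfolding G R' by simp
  qed
qed

text \<open>By countable choice, \<open>\<exists>m \<forall>g \<phi>(m, g)\<close> is equivalent to \<open>\<forall>g \<exists>m \<phi>(m, g\<^sub>m)\<close>, where
  \<open>g\<^sub>m\<close> is the \<open>m\<close>-th column of \<open>g\<close>.\<close>

lemma pi11_ex:
  assumes "pi11 (\<lambda>x w. R x (pfst w) (psnd w))"
  shows "pi11 (\<lambda>x n. \<exists>m. R x n m)"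
proof -
  obtain Q where Q: "decidable Q"
    and R: "\<And>x w. R x (pfst w) (psnd w) \<longleftrightarrow> (\<forall>g. \<exists>k. Q (join x g) (prod_encode (w, k)))"
    using assms unfolding pi11_def by blast
  let ?col = "\<lambda>g m j. g (prod_encode (m, j))"
  \<comment> \<open>The odd position \<open>2 * i + 1\<close> is redirected to entry
    \<open>i\<close> of column \<open>m\<close>.\<close>
  let ?G = "\<lambda>p m j. if even j then p j else p (Suc (2 * prod_encode (m, j div 2)))"
  have G: "?G (join x g) m = join x (?col g m)" for x g m
    by (auto simp: join_def fun_eq_iff)
  have R': "(\<exists>m. R x n m) \<longleftrightarrow>
      (\<forall>g. \<exists>m k. Q (join x (?col g m)) (prod_encode (prod_encode (n, m), k)))"
    (is "?l \<longleftrightarrow> ?r") for x n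
  proof
    assume ?l
    then obtain m where "R x n m" by blast
    then have "\<forall>g. \<exists>k. Q (join x g) (prod_encode (prod_encode (n, m), k))"
      using R[of x "prod_encode (n, m)"] by simp
    then show ?r by blast
  next
    assume r: ?r
    show ?l
    proof (rule ccontr)
      assume "\<not> ?l"
      then have "\<forall>m. \<exists>g. \<forall>k. \<not> Q (join x g) (prod_encode (prod_encode (n, m), k))"
        using R[of x "prod_encode (n, m)" for m] by simp
      then obtain h where h: "\<And>m k. \<not> Q (join x (h m)) (prod_encode (prod_encode (n, m), k))"
        by metis
      have "?col (\<lambda>z. h (pfst z) (psnd z)) m = h m" for m by simp
      with h spec[OF r, of "\<lambda>z. h (pfst z) (psnd z)"] show False by simp
    qed
  qed
  show ?thesis
  proof (rule pi11I)
    show "decidable (\<lambda>p w. Q (?G p (pfst (psnd w)))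
        (prod_encode (prod_encode (pfst w, pfst (psnd w)), psnd (psnd w))))"
      by (rule decidable_oracle_subst[OF Q]) (intro computable_intros)+
  next
    have "(\<exists>m k. P m k) \<longleftrightarrow> (\<exists>w. P (pfst w) (psnd w))" for P
      by (metis fst_conv prod_encode_inverse snd_conv)
    then show "(\<exists>m. R x n m) \<longleftrightarrow> (\<forall>g. \<exists>k. Q (?G (join x g) (pfst (psnd (prod_encode (n, k)))))
        (prod_encode (prod_encode (pfst (prod_encode (n, k)), pfst (psnd (prod_encode (n, k)))),
          psnd (psnd (prod_encode (n, k))))))" for x n
      unfolding G R' by simp
  qed
qed

section \<open>Halting as a \<open>\<Pi>\<^sup>1\<^sub>1\<close> relation\<close>

text \<open>
  In place of a step-counting universal machine we quantify over all tables \<open>T\<close> of the partial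
  recursive functions: an entry \<open>T e z\<close> is \<open>0\<close> if the \<open>e\<close>-th function is undefined at \<open>z\<close>, and the
  successor of its value otherwise. The recursion equations of \<^const>\<open>eval\<close> determine the table,
  and correctness at the arguments \<open>a b z m\<close> is decidable, since all the clauses, including those
  for minimization, have only bounded quantifiers.
\<close>

definition locally_correct :: "baire \<Rightarrow> (nat \<Rightarrow> nat \<Rightarrow> nat) \<Rightarrow> nat \<Rightarrow> nat \<Rightarrow> nat \<Rightarrow> nat \<Rightarrow> bool" where
  "locally_correct q T a b z m \<longleftrightarrow>
     T 0 z = 1 \<and> T 1 z = Suc (Suc z) \<and> T 2 z = Suc (pfst z) \<and> T 3 z = Suc (psnd z) \<and>
     T 4 z = Suc (q z) \<and>
     T (5 + 4 * prod_encode (a, b)) z =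
       (if T a z = 0 \<or> T b z = 0 then 0 else Suc (prod_encode (T a z - 1, T b z - 1))) \<and>
     T (6 + 4 * prod_encode (a, b)) z = (if T b z = 0 then 0 else T a (T b z - 1)) \<and>
     T (7 + 4 * prod_encode (a, b)) (prod_encode (z, 0)) = T a z \<and>
     T (7 + 4 * prod_encode (a, b)) (prod_encode (z, Suc m)) =
       (if T (7 + 4 * prod_encode (a, b)) (prod_encode (z, m)) = 0 then 0
        else T b (prod_encode (z, prod_encode
          (m, T (7 + 4 * prod_encode (a, b)) (prod_encode (z, m)) - 1)))) \<and>
     (T (8 + 4 * a) z = 0 \<longrightarrow> T a (prod_encode (z, m)) = 1 \<longrightarrow>
       (\<exists>i<m. T a (prod_encode (z, i)) = 0)) \<and>
     (T (8 + 4 * a) z = Suc m \<longrightarrow>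
       T a (prod_encode (z, m)) = 1 \<and> (\<forall>i<m. 2 \<le> T a (prod_encode (z, i))))"

text \<open>Replaces \<open>LEAST\<close> by the condition that only positive values precede the
  zero, as in the last clause of \<open>locally_correct\<close>.\<close>

lemma eval_Mu_eq_Some:
  "eval q (Mu c) z = Some n \<longleftrightarrow> eval q c (prod_encode (z, n)) = Some 0 \<and>
     (\<forall>i<n. \<exists>v>0. eval q c (prod_encode (z, i)) = Some v)" (is "_ \<longleftrightarrow> ?r")
proof
  assume "eval q (Mu c) z = Some n"
  then have n: "n = (LEAST n. eval q c (prod_encode (z, n)) = Some 0)"
    "eval q c (prod_encode (z, n)) = Some 0" "\<forall>i<n. eval q c (prod_encode (z, i)) \<noteq> None"
    by (auto simp: Let_def split: if_splits)
  moreover have "eval q c (prod_encode (z, i)) \<noteq> Some 0" if "i < n" for i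
    using that n(1) not_less_Least by blast
  ultimately show ?r by (metis neq0_conv not_Some_eq)
next
  assume r: ?r
  then have "(LEAST n. eval q c (prod_encode (z, n)) = Some 0) = n"
    by (intro Least_equality) (auto simp: not_less[symmetric])
  with r show "eval q (Mu c) z = Some n" by (auto simp: Let_def)
qed

lemma case_option_Suc_simps:
  "case_option 0 Suc x = 0 \<longleftrightarrow> x = None"
  "case_option 0 Suc x = Suc v \<longleftrightarrow> x = Some v"
  "2 \<le> case_option 0 Suc x \<longleftrightarrow> (\<exists>v>0. x = Some v)"
  by (auto split: option.splits)

text \<open>Uniqueness of the table: by induction on programs, each entry is forced by the entries
  of the immediate subprograms.\<close>

lemma locally_correct_imp_eval:
  assumes T: "\<forall>a b z m. locally_correct q T a b z m"
  shows "T (code c) z = case_option 0 Suc (eval q c z)"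
proof (induction c arbitrary: z)
  case (Tuple c d)
  then show ?case using T unfolding locally_correct_def
    by (auto split: option.splits)
next
  case (Comp c d)
  then show ?case using T unfolding locally_correct_def
    by (auto split: option.splits)
next
  case (Rec c d)
  \<comment> \<open>The entry at \<open>Suc n\<close> refers to the entry of the same program at
    \<open>n\<close>, hence an inner induction.\<close>
  have "T (code (Rec c d)) (prod_encode (y, n)) = case_option 0 Suc (eval q (Rec c d) (prod_encode (y, n)))"
    for y n
  proof (induction n)
    case 0
    then show ?case using T Rec.IH unfolding locally_correct_def by simp
  next
    case (Suc n)
    then show ?case using T Rec.IH unfolding locally_correct_def by (auto split: option.splits)
  qed
  then show ?case by (metis prod.collapse prod_decode_inverse)
next
  case (Mu c)
  show ?case
  proof (cases "T (code (Mu c)) z")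
    case 0
    \<comment> \<open>If the search returned \<open>n\<close>, the clause at \<open>m = n\<close>
      would give an undefined value below \<open>n\<close>, which a successful search
      excludes.\<close>
    have "eval q (Mu c) z \<noteq> Some n" for n
    proof
      assume n: "eval q (Mu c) z = Some n"
      then have "T (code c) (prod_encode (z, n)) = 1"
        using Mu.IH unfolding eval_Mu_eq_Some by simp
      with 0 T obtain i where "i < n" "T (code c) (prod_encode (z, i)) = 0"
        unfolding locally_correct_def code.simps by blast
      with n show False unfolding eval_Mu_eq_Some Mu.IH by fastforce
    qed
    with 0 show ?thesis by (metis not_Some_eq option.case(1))
  next
    case (Suc n)
    then have "T (code c) (prod_encode (z, n)) = 1" "\<forall>i<n. 2 \<le> T (code c) (prod_encode (z, i))"
      using T unfolding locally_correct_def code.simps by blast+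
    then have "eval q (Mu c) z = Some n"
      unfolding eval_Mu_eq_Some Mu.IH by (simp add: case_option_Suc_simps)
    with Suc show ?thesis by simp
  qed
qed (use T in \<open>simp_all add: locally_correct_def\<close>)

text \<open>Existence of a correct table, so that quantifying over correct tables is not
  vacuous.\<close>

lemma locally_correct_phi:
  "locally_correct q (\<lambda>e z. case_option 0 Suc (phi q e z)) a b z m"
proof -
  obtain c d where ab: "a = code c" "b = code d" using surj_code by metis
  have phi_code: "phi q (code c) = eval q c" for c
    by (simp add: phi_def inv_f_f[OF bij_is_inj[OF bij_code]])
  have phi_simps: "phi q 0 = eval q Zero" "phi q 1 = eval q Succ" "phi q 2 = eval q Fst"
    "phi q 3 = eval q Snd" "phi q 4 = eval q Query"
    "phi q (5 + 4 * prod_encode (code c, code d)) = eval q (Tuple c d)"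
    "phi q (6 + 4 * prod_encode (code c, code d)) = eval q (Comp c d)"
    "phi q (7 + 4 * prod_encode (code c, code d)) = eval q (Rec c d)"
    "phi q (8 + 4 * code c) = eval q (Mu c)"
    using phi_code[of Zero] phi_code[of Succ] phi_code[of Fst] phi_code[of Snd] phi_code[of Query]
      phi_code[of "Tuple c d"] phi_code[of "Comp c d"] phi_code[of "Rec c d"] phi_code[of "Mu c"]
    by (simp_all only: code.simps)
  \<comment> \<open>If a zero exists but the minimization diverges, some value below the least zero
    is undefined.\<close>
  have Mu0: "\<exists>i<m. eval q c (prod_encode (z, i)) = None"
    if "eval q (Mu c) z = None" "eval q c (prod_encode (z, m)) = Some 0"
  proof -
    define n where "n = (LEAST n. eval q c (prod_encode (z, n)) = Some 0)"
    have "eval q c (prod_encode (z, n)) = Some 0" "n \<le> m"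
      using that(2) unfolding n_def by (auto intro: LeastI Least_le)
    moreover from this that(1) have "\<exists>i<n. eval q c (prod_encode (z, i)) = None"
      by (auto simp: Let_def simp flip: n_def split: if_splits)
    ultimately show ?thesis by (meson less_le_trans)
  qed
  show ?thesis
    unfolding locally_correct_def ab phi_simps phi_code case_option_Suc_simps eval_Mu_eq_Some
    using Mu0 by (auto split: option.splits simp: case_option_Suc_simps)
qed

text \<open>Forward, uniqueness fixes the entry of any table violating no clause; backward, take the
  true table. The right side has the quantifier shape required by \<open>pi11\<close>.\<close>

lemma phi_defined_iff_tables:
  "n \<in> dom (phi q e) \<longleftrightarrow>
     (\<forall>T. \<exists>a b z m. \<not> locally_correct q T a b z m \<or> T e n \<noteq> 0)" (is "_ \<longleftrightarrow> ?r")
proof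
  assume n: "n \<in> dom (phi q e)"
  obtain c where c: "e = code c" using surj_code by metis
  have "T e n \<noteq> 0" if "\<forall>a b z m. locally_correct q T a b z m" for T
    using n locally_correct_imp_eval[OF that, of c n]
    by (auto simp: c phi_def inv_f_f[OF bij_is_inj[OF bij_code]])
  then show ?r by blast
next
  assume ?r
  then have "case_option 0 Suc (phi q e n) \<noteq> 0" using locally_correct_phi by blast
  then show "n \<in> dom (phi q e)" by (auto split: option.splits)
qed

abbreviation Pi11_name :: "baire \<Rightarrow> nat set" where
  "Pi11_name x \<equiv> Pi11_enum (x 0) (\<lambda>i. x (Suc i))"

lemma pi11_name: "pi11 (\<lambda>x n. n \<in> Pi11_name x)"
proof -
  \<comment> \<open>A single \<open>g\<close> carries \<open>f\<close> at its even and the table at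
    its odd positions. \<open>?q\<close> rebuilds the oracle from \<open>f\<close> and the tail of
    \<open>x\<close>, skipping the index \<open>x 0\<close>.\<close>
  let ?q = "\<lambda>p j. if even j then p (2 * Suc (j div 2)) else p (Suc (2 * (2 * (j div 2))))"
  let ?T = "\<lambda>p e z. p (Suc (2 * Suc (2 * prod_encode (e, z))))"
  let ?Q = "\<lambda>p w. \<not> locally_correct (?q p) (?T p) (pfst (pfst (psnd w))) (psnd (pfst (psnd w)))
      (pfst (psnd (psnd w))) (psnd (psnd (psnd w))) \<or> ?T p (p 0) (pfst w) \<noteq> 0"
  have q: "?q (join x (join f t)) = join (\<lambda>i. x (Suc i)) f" for x f t
    unfolding join_double by (auto simp: join_def[of "\<lambda>i. x (Suc i)"] fun_eq_iff)
  have join0: "join x g 0 = x 0" for x g by (simp add: join_def)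
  have T: "join x (join f (\<lambda>z. T (pfst z) (psnd z))) (Suc (2 * Suc (2 * prod_encode (e, z)))) = T e z"
    for x f T e z
    unfolding join_double by simp
  \<comment> \<open>Every \<open>g\<close> splits in this way because the pairing is onto.\<close>
  have split_join: "(\<forall>g. P g) \<longleftrightarrow> (\<forall>f T. P (join f (\<lambda>z. T (pfst z) (psnd z))))" for P
  proof
    assume r: "\<forall>f T. P (join f (\<lambda>z. T (pfst z) (psnd z)))"
    show "\<forall>g. P g"
    proof
      fix g :: baire
      have "join (\<lambda>j. g (2 * j)) (\<lambda>z. g (Suc (2 * prod_encode (pfst z, psnd z)))) = g"
        by (auto simp: join_def fun_eq_iff)
      with r[THEN spec, THEN spec, of "\<lambda>j. g (2 * j)" "\<lambda>e z. g (Suc (2 * prod_encode (e, z)))"]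
      show "P g" by simp
    qed
  qed blast
  have split_tuple: "(\<exists>a b z m. P a b z m) \<longleftrightarrow>
      (\<exists>k. P (pfst (pfst k)) (psnd (pfst k)) (pfst (psnd k)) (psnd (psnd k)))" for P
    by (metis fst_conv prod_encode_inverse snd_conv)
  show ?thesis
  proof (rule pi11I)
    show "decidable ?Q" unfolding locally_correct_def by (intro computable_intros)
  next
    show "n \<in> Pi11_name x \<longleftrightarrow> (\<forall>g. \<exists>k. ?Q (join x g) (prod_encode (n, k)))" for x n
      unfolding Pi11_enum_def phi_defined_iff_tables split_tuple
        split_join[of "\<lambda>g. \<exists>k. ?Q (join x g) (prod_encode (n, k))"]
      unfolding q T join0 by simp
  qed
qed

section \<open>The reductions\<close>

lemma weihrauch_le_via_index:
  assumes "out_rep f = delta_omega" "out_rep g = delta_omega"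
    and "\<And>x a b. in_rep f x = Some a \<Longrightarrow> solution f a = Some b \<Longrightarrow>
      \<exists>a'. in_rep g (case_nat e x) = Some a' \<and> solution g a' = Some b"
  shows "f \<le>\<^sub>W g"
proof -
  have computable: "partial_computable (\<lambda>x. Some (F x))" if "computable F" for F
    using that unfolding computable_def partial_computable_def functional_def map_le_def
    by (metis (no_types, lifting) ext option.distinct(1) option.sel)
  have "computable (\<lambda>x n. if n = 0 then e else x (n - 1))" by (intro computable_intros)
  moreover have "(\<lambda>n. if n = 0 then e else x (n - 1)) = case_nat e x" for x :: baire
    by (auto split: nat.splits)
  ultimately have h: "partial_computable (\<lambda>x. Some (case_nat e x))" using computable by simp
  \<comment> \<open>Position 1 of \<open>join x y\<close> is \<open>y 0\<close>, the answer;
    \<open>delta_omega\<close> looks only at entry 0.\<close>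
  have k: "partial_computable (\<lambda>x. Some (\<lambda>n. x 1))"
    by (intro computable computable_intros)
  show ?thesis
    unfolding weihrauch_le_def
  proof (rule exI[of _ "\<lambda>x. Some (case_nat e x)"], rule exI[of _ "\<lambda>x. Some (\<lambda>n. x 1)"],
      intro conjI allI impI h k)
    fix x a b
    assume "in_rep f x = Some a \<and> solution f a = Some b"
    then obtain a' where "in_rep g (case_nat e x) = Some a'" "solution g a' = Some b"
      using assms(3) by blast
    moreover have "out_rep f (\<lambda>n. join x y 1) = Some b" if "out_rep g y = Some b" for y
      using that by (simp add: assms(1,2) delta_omega_def join_def)
    ultimately show "\<exists>x' a' b'. Some (case_nat e x) = Some x' \<and> in_rep g x' = Some a' \<and>
        solution g a' = Some b' \<and> (\<forall>y. out_rep g y = Some b' \<longrightarrow>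
          (\<exists>z. Some (\<lambda>n. join x y 1) = Some z \<and> out_rep f z = Some b))"
      by blast
  qed
qed

lemma Pi11_name_in_Pi11_omega: "Pi11_name x \<in> Pi11_omega" "- Pi11_name x \<in> Sigma11_omega"
  by (auto simp: Pi11_omega_def Sigma11_omega_def)

lemmas problem_defs = delta_Pi11_def delta_Sigma11_def least_number_def cardinality_def
  Pi11_LNP_def Sigma11_LNP_def card_Pi11_def card_Sigma11_def

lemma initial_segment_Least:
  fixes A :: "nat set"
  assumes "A \<noteq> {}"
  shows "- {n. \<exists>m. m \<le> n \<and> m \<in> A} = {..<LEAST n. n \<in> A}"
proof -
  have "(LEAST n. n \<in> A) \<in> A" using assms by (auto intro: LeastI)
  then have "(\<exists>m. m \<le> n \<and> m \<in> A) \<longleftrightarrow> (LEAST n. n \<in> A) \<le> n" for n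
    by (auto intro: order_trans[OF Least_le])
  then show ?thesis by auto
qed

text \<open>Turns a bound on the cardinality into number quantifiers over membership in
  \<open>A\<close>. Backward, \<open>F\<close> is the code of \<open>A\<close> itself, which exists
  by finiteness.\<close>

lemma card_le_iff_set_decode:
  assumes "finite A"
  shows "card A \<le> n \<longleftrightarrow> (\<forall>F. card (set_decode F) \<le> n \<or> (\<exists>i. i \<in> set_decode F \<and> i \<notin> A))"
proof
  assume "card A \<le> n"
  with assms show "\<forall>F. card (set_decode F) \<le> n \<or> (\<exists>i. i \<in> set_decode F \<and> i \<notin> A)"
    by (meson card_mono le_trans subsetI)
next
  assume "\<forall>F. card (set_decode F) \<le> n \<or> (\<exists>i. i \<in> set_decode F \<and> i \<notin> A)"
  then have "card (set_decode (set_encode A)) \<le> n \<or>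
      (\<exists>i. i \<in> set_decode (set_encode A) \<and> i \<notin> A)" by blast
  with assms show "card A \<le> n" by (simp add: set_encode_inverse)
qed

text \<open>The index describes the upward closure of \<open>A\<close>; its complement has exactly
  \<open>min A\<close> elements. The whole name \<open>x\<close>, including its own index, becomes
  the oracle.\<close>

lemma Pi11_LNP_le_card_Sigma11: "Pi11_LNP \<le>\<^sub>W card_Sigma11"
proof -
  have "pi11 (\<lambda>x n. \<exists>m. m \<le> n \<and> m \<in> Pi11_name x)"
    by (intro pi11_ex pi11_conj pi11_compose[OF pi11_name] computable_intros)
  then obtain e where e: "\<And>x. Pi11_enum e x = {n. \<exists>m. m \<le> n \<and> m \<in> Pi11_name x}"
    by (rule pi11_enum) blast
  show ?thesis
  proof (rule weihrauch_le_via_index[where e = e])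
    fix x A b
    assume "in_rep Pi11_LNP x = Some A" "solution Pi11_LNP A = Some b"
    then have A: "A = Pi11_name x" "A \<noteq> {}" "b = (LEAST n. n \<in> A)"
      by (auto simp: problem_defs split: if_splits)
    have "- Pi11_enum e x = {..<b}"
      unfolding e A(1)[symmetric] A(3) by (rule initial_segment_Least[OF A(2)])
    then show "\<exists>a'. in_rep card_Sigma11 (case_nat e x) = Some a' \<and> solution card_Sigma11 a' = Some b"
      using Pi11_name_in_Pi11_omega(2)[of "case_nat e x"] by (simp add: problem_defs)
  qed (simp_all add: problem_defs)
qed

text \<open>Dually, the numbers \<open>n\<close> with no element of \<open>A\<close> up to
  \<open>n\<close> are described directly, using a universal quantifier over the complement of
  \<open>A\<close>.\<close>

lemma Sigma11_LNP_le_card_Pi11: "Sigma11_LNP \<le>\<^sub>W card_Pi11"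
proof -
  have "pi11 (\<lambda>x n. \<forall>m. n < m \<or> m \<in> Pi11_name x)"
    by (intro pi11_all pi11_disj pi11_compose[OF pi11_name] computable_intros)
  then obtain e where e: "\<And>x. Pi11_enum e x = {n. \<forall>m. n < m \<or> m \<in> Pi11_name x}"
    by (rule pi11_enum) blast
  show ?thesis
  proof (rule weihrauch_le_via_index[where e = e])
    fix x A b
    assume "in_rep Sigma11_LNP x = Some A" "solution Sigma11_LNP A = Some b"
    then have A: "A = - Pi11_name x" "A \<noteq> {}" "b = (LEAST n. n \<in> A)"
      by (auto simp: problem_defs split: if_splits)
    have "Pi11_enum e x = - {n. \<exists>m. m \<le> n \<and> m \<in> A}"
      unfolding e A(1) by (auto simp flip: not_less)
    then have "Pi11_enum e x = {..<b}" using initial_segment_Least[OF A(2)] A(3) by simp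
    then show "\<exists>a'. in_rep card_Pi11 (case_nat e x) = Some a' \<and> solution card_Pi11 a' = Some b"
      using Pi11_name_in_Pi11_omega(1)[of "case_nat e x"] by (simp add: problem_defs)
  qed (simp_all add: problem_defs)
qed

lemma card_Sigma11_le_Pi11_LNP: "card_Sigma11 \<le>\<^sub>W Pi11_LNP"
proof -
  \<comment> \<open>Since \<open>A\<close> is the complement of the named set, the last disjunct
    says that \<open>F\<close> codes no subset of \<open>A\<close>. For finite \<open>A\<close>,
    these \<open>n\<close> are the upper bounds of \<open>card A\<close>.\<close>
  have "pi11 (\<lambda>x n. \<forall>F. card (set_decode F) \<le> n \<or> (\<exists>i. i \<in> set_decode F \<and> i \<in> Pi11_name x))"
    by (intro pi11_all pi11_disj pi11_ex pi11_conj pi11_compose[OF pi11_name] computable_intros)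
  then obtain e where e: "\<And>x. Pi11_enum e x =
      {n. \<forall>F. card (set_decode F) \<le> n \<or> (\<exists>i. i \<in> set_decode F \<and> i \<in> Pi11_name x)}"
    by (rule pi11_enum) blast
  show ?thesis
  proof (rule weihrauch_le_via_index[where e = e])
    fix x A b
    assume "in_rep card_Sigma11 x = Some A" "solution card_Sigma11 A = Some b"
    then have A: "A = - Pi11_name x" "finite A" "b = card A"
      by (auto simp: problem_defs split: if_splits)
    have "Pi11_enum e x = {b..}"
      unfolding e A(3) atLeast_def card_le_iff_set_decode[OF A(2)] by (simp add: A(1))
    then show "\<exists>a'. in_rep Pi11_LNP (case_nat e x) = Some a' \<and> solution Pi11_LNP a' = Some b"
      using Pi11_name_in_Pi11_omega(1)[of "case_nat e x"]
      by (auto simp: problem_defs intro!: Least_equality)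
  qed (simp_all add: problem_defs)
qed

lemma card_Pi11_le_Sigma11_LNP: "card_Pi11 \<le>\<^sub>W Sigma11_LNP"
proof -
  \<comment> \<open>Here the named set is \<open>A\<close> itself: some finite subset of
    \<open>A\<close> has more than \<open>n\<close> elements. The complement consists of the upper
    bounds of \<open>card A\<close>, with least element \<open>card A\<close>.\<close>
  have "pi11 (\<lambda>x n. \<exists>F. n < card (set_decode F) \<and> (\<forall>i. i \<notin> set_decode F \<or> i \<in> Pi11_name x))"
    by (intro pi11_all pi11_disj pi11_ex pi11_conj pi11_compose[OF pi11_name] computable_intros)
  then obtain e where e: "\<And>x. Pi11_enum e x =
      {n. \<exists>F. n < card (set_decode F) \<and> (\<forall>i. i \<notin> set_decode F \<or> i \<in> Pi11_name x)}"
    by (rule pi11_enum) blast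
  show ?thesis
  proof (rule weihrauch_le_via_index[where e = e])
    fix x A b
    assume "in_rep card_Pi11 x = Some A" "solution card_Pi11 A = Some b"
    then have A: "A = Pi11_name x" "finite A" "b = card A"
      by (auto simp: problem_defs split: if_splits)
    have "- Pi11_enum e x = {b..}"
      unfolding e A(3) atLeast_def card_le_iff_set_decode[OF A(2)] by (auto simp: A(1) simp flip: not_le)
    then show "\<exists>a'. in_rep Sigma11_LNP (case_nat e x) = Some a' \<and> solution Sigma11_LNP a' = Some b"
      using Pi11_name_in_Pi11_omega(2)[of "case_nat e x"]
      by (auto simp: problem_defs intro!: Least_equality)
  qed (simp_all add: problem_defs)
qed

theorem proposition3p6:
  "Pi11_LNP \<equiv>\<^sub>W card_Sigma11 \<and> Sigma11_LNP \<equiv>\<^sub>W card_Pi11"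
  unfolding weihrauch_equiv_def
  using Pi11_LNP_le_card_Sigma11 card_Sigma11_le_Pi11_LNP
    Sigma11_LNP_le_card_Pi11 card_Pi11_le_Sigma11_LNP by blast

end
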